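(* The problems $(\mathcal{P}_1)$ and $(\mathcal{P}_3)$ defined in the context are equivalent in the sense that the optimal $\mathbf W$ is identical; that is, $\mathbf W$ is optimal for $(\mathcal{P}_1)$ if and only if there exist $\mathbf A,\mathbf u$ such that $(\mathbf W,\mathbf A,\mathbf u)$ is optimal for $(\mathcal{P}_3)$.
   Context: Setting. $S$ satellites ($\mathcal S=\{1,\dots,S\}$), each with $N_{\rm T}=N_{\rm v}N_{\rm h}$ antennas, serve $K$ single-antenna users ($\mathcal K=\{1,\dots,K\}$). $(\cdot)^*$, $(\cdot)^T$, $(\cdot)^H$ denote conjugate, transpose, conjugate transpose. Channels. $\bar{\mathbf h}_{s,k}=a_{s,k}\varphi_{s,k}\mathbf v(\boldsymbol\theta_{s,k})\in\mathbb C^{N_{\rm T}\times 1}$ is a random vector, where $a_{s,k}$ is a complex Rician coefficient with Rician factor $\kappa_{s,k}>0$ and average power $\mathbb E\{|a_{s,k}|^2\}=\gamma_{s,k}>0$, $\varphi_{s,k}$ is a random phase error with $|\varphi_{s,k}|=1$ and mean $\bar\varphi_{s,k}=\mathbb E\{\varphi_{s,k}\}$, and $\mathbf v(\boldsymbol\theta_{s,k})$ is the deterministic column vector $\mathbf v_{N_{\rm v}}(\cos\theta^{\rm y}_{s,k})\otimes\mathbf v_{N_{\rm h}}(\sin\theta^{\rm y}_{s,k}\cos\theta^{\rm x}_{s,k})$ with $\mathbf v_N(x)=\frac{1}{\sqrt{N_{\rm T}}}[1,e^{-j\pi x},\dots,e^{-j\pi(N-1)x}]^T$ for real angles $\theta^{\rm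 x}_{s,k},\theta^{\rm y}_{s,k}$. The statistics are $$\mathbb E\{\bar{\mathbf h}_{s,k}\}=\rho_{s,k}\mathbf v(\boldsymbol\theta_{s,k}),\qquad \rho_{s,k}=\sqrt{\tfrac{\kappa_{s,k}\gamma_{s,k}}{2(\kappa_{s,k}+1)}}\,(1+j)\,\bar\varphi_{s,k},$$ $$\boldsymbol\Omega_{s_1|s_2,k}=\mathbb E\{\bar{\mathbf h}^*_{s_1,k}\bar{\mathbf h}^T_{s_2,k}\}=\begin{cases}\gamma_{s,k}\mathbf v^*(\boldsymbol\theta_{s,k})\mathbf v^T(\boldsymbol\theta_{s,k}), & s_1=s_2=s,\\ \rho^*_{s_1,k}\rho_{s_2,k}\mathbf v^*(\boldsymbol\theta_{s_1,k})\mathbf v^T(\boldsymbol\theta_{s_2,k}), & s_1\ne s_2.\end{cases}$$ Let $\bar{\mathbf h}_k=[\bar{\mathbf h}_{1,k}^T,\dots,\bar{\mathbf h}_{S,k}^T]^T\in\mathbb C^{SN_{\rm T}}$, $\boldsymbol\Omega_k=\mathbb E\{\bar{\mathbf h}_k^*\bar{\mathbf h}_k^T\}$ (with blocks $\boldsymbol\Omega_{s_1|s_2,k}$), and $\tilde{\boldsymbol\Omega}_k=\mathrm{BlkDiag}\{\boldsymbol\Omega_{1|1,k},\dots,\boldsymbol\Omega_{S|S,k}\}$. For each $k$, $\mathbf Q_k\in\mathbb C^{r\times SN_{\rm T}}$ is a fixed matrix with $\boldsymbol\Omega_k=\mathbf Q_k^H\mathbf Q_k$. Precoders. $\mathbf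 w_{s,k}\in\mathbb C^{N_{\rm T}}$, $\mathbf w_k=[\mathbf w_{1,k}^T,\dots,\mathbf w_{S,k}^T]^T$, $\mathbf W_s=[\mathbf w_{s,1},\dots,\mathbf w_{s,K}]$; $\mathbf W$ denotes the collection of all $\mathbf w_{s,k}$. The noise powers satisfy $\sigma_k^2>0$, the user weights $\beta_k\ge 0$ are fixed, and $P_s>0$ are the satellite power budgets. Problem $(\mathcal P_1)$: maximize over $\mathbf W$ the function $\sum_{k}\beta_k\bar R_k$ subject to $\mathrm{Tr}(\mathbf W_s\mathbf W_s^H)\le P_s$ for all $s\in\mathcal S$, where $$\bar R_k=\log_2\Big(1+\frac{\mathbf w_k^H\boldsymbol\Omega_k\mathbf w_k}{\sum_{i\ne k}\mathbf w_i^H\tilde{\boldsymbol\Omega}_k\mathbf w_i+\sigma_k^2}\Big).$$ Problem $(\mathcal P_3)$: minimize over $\mathbf W$, $\mathbf A=[\mathbf a_1,\dots,\mathbf a_K]\in\mathbb C^{r\times K}$ and $\mathbf u=(u_1,\dots,u_K)$ with $u_k>0$ the function $\sum_k\beta_k(u_k\tilde e_k-\log_2 u_k)$ subject to $\mathrm{Tr}(\mathbf W_s\mathbf W_s^H)\le P_s$ for all $s\in\mathcal S$, where $$\tilde e_k=\mathbf a_k^H\mathbf a_k\Big(\sum_{i\ne k}\mathbf w_i^H\tilde{\boldsymbol\Omega}_k\mathbf w_i+\mathbf w_k^H\boldsymbol\Omega_k\mathbf w_k\Big)-\mathbf a_k^H\mathbf Q_k\mathbf w_k-\mathbf w_k^H\mathbf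 Q_k^H\mathbf a_k+\mathbf a_k^H\mathbf a_k\sigma_k^2+1.$$ *)

theory Defs
  imports
    "HOL-Probability.Probability"
    "Jordan_Normal_Form.Schur_Decomposition"
begin

unbundle no vec_syntax
unbundle no inner_syntax

(* All indices (satellites, users, antennas) run from 0. Vectors and matrices are those of
   Jordan_Normal_Form. The conjugate transpose of a matrix is mat_adjoint. *)


(* x^H y; the first argument is conjugated. *)
definition herm_dot :: "complex Matrix.vec \<Rightarrow> complex Matrix.vec \<Rightarrow> complex" where
  "herm_dot x y = conjugate x \<bullet> y"

(* w^H B w. Only used with Hermitian B, for which this is a real number. *)
definition quad_form :: "complex Matrix.mat \<Rightarrow> complex Matrix.vec \<Rightarrow> real" where
  "quad_form B w = Re (herm_dot w (B *\<^sub>v w))"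

definition mat_trace :: "complex Matrix.mat \<Rightarrow> complex" where
  "mat_trace B = (\<Sum>i<dim_row B. B $$ (i, i))"

(* x y^T, without conjugation. *)
definition outer_prod :: "complex Matrix.vec \<Rightarrow> complex Matrix.vec \<Rightarrow> complex Matrix.mat" where
  "outer_prod x y = Matrix.mat (dim_vec x) (dim_vec y) (\<lambda>(i, j). x $ i * y $ j)"

definition kron_vec :: "complex Matrix.vec \<Rightarrow> complex Matrix.vec \<Rightarrow> complex Matrix.vec" where
  "kron_vec x y = Matrix.vec (dim_vec x * dim_vec y) (\<lambda>i. x $ (i div dim_vec y) * y $ (i mod dim_vec y))"

(* [x_0^T, ..., x_{S-1}^T]^T for vectors x_s of length N. *)
definition stack_vec :: "nat \<Rightarrow> nat \<Rightarrow> (nat \<Rightarrow> complex Matrix.vec) \<Rightarrow> complex Matrix.vec" where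
  "stack_vec S N x = Matrix.vec (S * N) (\<lambda>i. x (i div N) $ (i mod N))"


definition expect_vec :: "'o measure \<Rightarrow> nat \<Rightarrow> ('o \<Rightarrow> complex Matrix.vec) \<Rightarrow> complex Matrix.vec" where
  "expect_vec M n X = Matrix.vec n (\<lambda>i. \<integral>\<omega>. X \<omega> $ i \<partial>M)"

definition expect_mat ::
  "'o measure \<Rightarrow> nat \<Rightarrow> nat \<Rightarrow> ('o \<Rightarrow> complex Matrix.mat) \<Rightarrow> complex Matrix.mat" where
  "expect_mat M m n X = Matrix.mat m n (\<lambda>(i, j). \<integral>\<omega>. X \<omega> $$ (i, j) \<partial>M)"

(* E{x^* y^T} for random vectors x, y of length n. *)
definition correlation ::
  "'o measure \<Rightarrow> nat \<Rightarrow> ('o \<Rightarrow> complex Matrix.vec) \<Rightarrow> ('o \<Rightarrow> complex Matrix.vec) \<Rightarrow> complex Matrix.mat" where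
  "correlation M n x y = expect_mat M n n (\<lambda>\<omega>. outer_prod (conjugate (x \<omega>)) (y \<omega>))"

(* Real and imaginary part are i.i.d. Gaussian with mean sqrt (kappa gamma / (2 (kappa + 1)))
   and variance gamma / (2 (kappa + 1)). The line-of-sight component thus has phase pi/4
   (the factor 1 + j in the channel mean), the ratio of line-of-sight to scattered power is
   kappa and the total power is gamma. *)
definition complex_rician :: "'o measure \<Rightarrow> ('o \<Rightarrow> complex) \<Rightarrow> real \<Rightarrow> real \<Rightarrow> bool" where
  "complex_rician M a \<kappa> \<gamma> \<longleftrightarrow>
     (let \<mu> = sqrt (\<kappa> * \<gamma> / (2 * (\<kappa> + 1))); \<tau> = sqrt (\<gamma> / (2 * (\<kappa> + 1)))
      in prob_space.indep_var M borel (\<lambda>\<omega>. Re (a \<omega>)) borel (\<lambda>\<omega>. Im (a \<omega>)) \<and>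
         distributed M lborel (\<lambda>\<omega>. Re (a \<omega>)) (normal_density \<mu> \<tau>) \<and>
         distributed M lborel (\<lambda>\<omega>. Im (a \<omega>)) (normal_density \<mu> \<tau>))"

(* The normalisation is by the total number NT of antennas of the array, also for a factor of
   length N < NT. *)
definition steering_factor :: "nat \<Rightarrow> nat \<Rightarrow> real \<Rightarrow> complex Matrix.vec" where
  "steering_factor NT N x =
     Matrix.vec N (\<lambda>n. complex_of_real (1 / sqrt (real NT)) * exp (- \<i> * complex_of_real (pi * real n * x)))"

definition steering :: "nat \<Rightarrow> nat \<Rightarrow> real \<Rightarrow> real \<Rightarrow> complex Matrix.vec" where
  "steering Nv Nh \<theta>x \<theta>y =
     kron_vec (steering_factor (Nv * Nh) Nv (cos \<theta>y)) (steering_factor (Nv * Nh) Nh (sin \<theta>y * cos \<theta>x))"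


(* In all definitions below, W s k is the precoder w_{s,k} of satellite s for user k, and
   stack_vec S N (\<lambda>s. W s k) is w_k. *)

definition power_feasible ::
  "nat \<Rightarrow> nat \<Rightarrow> nat \<Rightarrow> (nat \<Rightarrow> real) \<Rightarrow> (nat \<Rightarrow> nat \<Rightarrow> complex Matrix.vec) \<Rightarrow> bool" where
  "power_feasible S N K P W \<longleftrightarrow>
     (\<forall>s<S. \<forall>k<K. W s k \<in> carrier_vec N) \<and>
     (\<forall>s<S. let Ws = mat_of_cols N (map (W s) [0..<K]) in Re (mat_trace (Ws * mat_adjoint Ws)) \<le> P s)"

definition interference ::
  "nat \<Rightarrow> nat \<Rightarrow> nat \<Rightarrow> (nat \<Rightarrow> complex Matrix.mat) \<Rightarrow> (nat \<Rightarrow> nat \<Rightarrow> complex Matrix.vec) \<Rightarrow> nat \<Rightarrow> real" where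
  "interference S N K \<Omega>t W k = (\<Sum>i\<in>{..<K} - {k}. quad_form (\<Omega>t k) (stack_vec S N (\<lambda>s. W s i)))"

definition rate ::
  "nat \<Rightarrow> nat \<Rightarrow> nat \<Rightarrow> (nat \<Rightarrow> complex Matrix.mat) \<Rightarrow> (nat \<Rightarrow> complex Matrix.mat) \<Rightarrow> (nat \<Rightarrow> real) \<Rightarrow>
   (nat \<Rightarrow> nat \<Rightarrow> complex Matrix.vec) \<Rightarrow> nat \<Rightarrow> real" where
  "rate S N K \<Omega> \<Omega>t \<sigma> W k =
     log 2 (1 + quad_form (\<Omega> k) (stack_vec S N (\<lambda>s. W s k)) / (interference S N K \<Omega>t W k + (\<sigma> k)\<^sup>2))"

definition P1_optimal ::
  "nat \<Rightarrow> nat \<Rightarrow> nat \<Rightarrow> (nat \<Rightarrow> complex Matrix.mat) \<Rightarrow> (nat \<Rightarrow> complex Matrix.mat) \<Rightarrow> (nat \<Rightarrow> real) \<Rightarrow>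
   (nat \<Rightarrow> real) \<Rightarrow> (nat \<Rightarrow> real) \<Rightarrow> (nat \<Rightarrow> nat \<Rightarrow> complex Matrix.vec) \<Rightarrow> bool" where
  "P1_optimal S N K \<Omega> \<Omega>t \<sigma> \<beta> P W \<longleftrightarrow>
     is_arg_max (\<lambda>W. \<Sum>k<K. \<beta> k * rate S N K \<Omega> \<Omega>t \<sigma> W k) (power_feasible S N K P) W"

(* The expression under Re is real whenever \<Omega> k and \<Omega>t k are Hermitian. *)
definition mse ::
  "nat \<Rightarrow> nat \<Rightarrow> nat \<Rightarrow> (nat \<Rightarrow> complex Matrix.mat) \<Rightarrow> (nat \<Rightarrow> complex Matrix.mat) \<Rightarrow> (nat \<Rightarrow> complex Matrix.mat) \<Rightarrow>
   (nat \<Rightarrow> real) \<Rightarrow> (nat \<Rightarrow> nat \<Rightarrow> complex Matrix.vec) \<Rightarrow> complex Matrix.mat \<Rightarrow> nat \<Rightarrow> real" where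
  "mse S N K \<Omega> \<Omega>t Q \<sigma> W A k =
     (let a = col A k; w = stack_vec S N (\<lambda>s. W s k)
      in Re (herm_dot a a * complex_of_real (interference S N K \<Omega>t W k + quad_form (\<Omega> k) w)
             - herm_dot a (Q k *\<^sub>v w)
             - herm_dot w (mat_adjoint (Q k) *\<^sub>v a)
             + herm_dot a a * complex_of_real ((\<sigma> k)\<^sup>2) + 1))"

definition P3_optimal ::
  "nat \<Rightarrow> nat \<Rightarrow> nat \<Rightarrow> nat \<Rightarrow> (nat \<Rightarrow> complex Matrix.mat) \<Rightarrow> (nat \<Rightarrow> complex Matrix.mat) \<Rightarrow>
   (nat \<Rightarrow> complex Matrix.mat) \<Rightarrow> (nat \<Rightarrow> real) \<Rightarrow> (nat \<Rightarrow> real) \<Rightarrow> (nat \<Rightarrow> real) \<Rightarrow>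
   (nat \<Rightarrow> nat \<Rightarrow> complex Matrix.vec) \<Rightarrow> complex Matrix.mat \<Rightarrow> (nat \<Rightarrow> real) \<Rightarrow> bool" where
  "P3_optimal S N K r \<Omega> \<Omega>t Q \<sigma> \<beta> P W A u \<longleftrightarrow>
     is_arg_min (\<lambda>(W, A, u). \<Sum>k<K. \<beta> k * (u k * mse S N K \<Omega> \<Omega>t Q \<sigma> W A k - log 2 (u k)))
       (\<lambda>(W, A, u). power_feasible S N K P W \<and> A \<in> carrier_mat r K \<and> (\<forall>k<K. u k > 0))
       (W, A, u)"

end

(* Fix W and write q = Q_k w_k and T = interference + sigma_k^2 > 0, so that w_k^H Omega_k w_k = |q|^2.
   Completing the square in a_k, the minimum of e_k is T / (T + |q|^2) = 2 powr (- R_k), attained at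
   a_k = q / (T + |q|^2). By ln t <= t - 1, the minimum over u_k > 0 of u_k e_k - log_2 u_k is
   log_2 e_k + c with a constant c, attained at u_k = 1 / (e_k ln 2). So, for every W, the minimum of
   the objective of (P3) over A and u exists and is a constant minus the objective of (P1). *)

theory Submission
  imports Defs
begin

section \<open>Partial minimisation and the scalar minimisation over a weight\<close>

text \<open>The two assumptions say that, for each feasible \<open>x\<close>, the minimum of
  \<open>g (x, y)\<close> over \<open>y\<close> exists and equals \<open>c - f x\<close>. A joint
  minimum can thus be taken first over \<open>y\<close> and then over \<open>x\<close>. The
  constraint \<open>q\<close> does not depend on \<open>x\<close>, so every feasible
  \<open>x\<close> may be combined with its own best \<open>y\<close>.\<close>

lemma is_arg_max_iff_ex_is_arg_min:
  fixes f :: "'a \<Rightarrow> real"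
  assumes lower: "\<And>x y. p x \<Longrightarrow> q y \<Longrightarrow> c - f x \<le> g (x, y)"
    and attained: "\<And>x. p x \<Longrightarrow> \<exists>y. q y \<and> g (x, y) = c - f x"
  shows "is_arg_max f p x \<longleftrightarrow> (\<exists>y. is_arg_min g (\<lambda>(x, y). p x \<and> q y) (x, y))"
proof
  assume max: "is_arg_max f p x"
  then obtain y where y: "q y" "g (x, y) = c - f x"
    using attained unfolding is_arg_max_def by blast
  \<comment> \<open>The chain is
    \<open>g (x, y) = c - f x \<le> c - f x' \<le> g (x', y')\<close>.\<close>
  have "\<not> g (x', y') < g (x, y)" if "p x'" "q y'" for x' y'
    using lower[OF that] max that(1) y(2) unfolding is_arg_max_linorder by force
  then show "\<exists>y. is_arg_min g (\<lambda>(x, y). p x \<and> q y) (x, y)"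
    using max y unfolding is_arg_min_def is_arg_max_def by auto
next
  assume "\<exists>y. is_arg_min g (\<lambda>(x, y). p x \<and> q y) (x, y)"
  then obtain y where min: "is_arg_min g (\<lambda>(x, y). p x \<and> q y) (x, y)" ..
  then have xy: "p x" "q y"
    unfolding is_arg_min_def by auto
  have "f x' \<le> f x" if x': "p x'" for x'
  proof -
    \<comment> \<open>Compare with a best partner \<open>y'\<close> of \<open>x'\<close>: then
      \<open>c - f x \<le> g (x, y) \<le> g (x', y') = c - f x'\<close>.\<close>
    obtain y' where "q y'" "g (x', y') = c - f x'"
      using attained[OF x'] by blast
    moreover from this(1) have "g (x, y) \<le> g (x', y')"
      using min x' unfolding is_arg_min_linorder by auto
    ultimately show ?thesis
      using lower[OF xy] by linarith
  qed
  then show "is_arg_max f p x"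
    using xy unfolding is_arg_max_linorder by auto
qed

text \<open>This is \<open>ln t \<le> t - 1\<close> at \<open>t = u * e * ln 2\<close>, divided by
  \<open>ln 2\<close>. The factor \<open>ln 2\<close> inside \<open>t\<close> converts the base of
  the logarithm and leaves the constant.\<close>

lemma mult_minus_log_ge:
  fixes e u :: real
  assumes "e > 0" "u > 0"
  shows "(1 + ln (ln 2)) / ln 2 + log 2 e \<le> u * e - log 2 u"
proof -
  have "ln (u * e * ln 2) \<le> u * e * ln 2 - 1"
    using assms by (intro ln_le_minus_one) auto
  then have "1 + ln (ln 2) + ln e \<le> u * e * ln 2 - ln u"
    using assms by (simp add: ln_mult)
  then have "(1 + ln (ln 2) + ln e) / ln 2 \<le> (u * e * ln 2 - ln u) / ln 2"
    by (intro divide_right_mono) auto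
  then show ?thesis
    by (simp add: log_def add_divide_distrib diff_divide_distrib)
qed

text \<open>Equality in \<open>ln t \<le> t - 1\<close> holds at \<open>t = 1\<close>, that is, at
  \<open>u = 1 / (e * ln 2)\<close>.\<close>

lemma mult_minus_log_eq:
  fixes e :: real
  assumes "e > 0"
  shows "1 / (e * ln 2) * e - log 2 (1 / (e * ln 2)) = (1 + ln (ln 2)) / ln 2 + log 2 e"
  using assms by (simp add: log_def ln_div ln_mult add_divide_distrib diff_divide_distrib)

section \<open>Hermitian products, adjoints and nonnegative quadratic forms\<close>

lemma herm_dot_eq_sum:
  "dim_vec x = dim_vec y \<Longrightarrow> herm_dot x y = (\<Sum>i<dim_vec y. cnj (x $ i) * y $ i)"
  by (simp add: herm_dot_def scalar_prod_def atLeast0LessThan)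

lemma herm_dot_self:
  "herm_dot x x = complex_of_real (\<Sum>i<dim_vec x. (cmod (x $ i))\<^sup>2)"
  unfolding of_real_sum
  by (simp add: herm_dot_eq_sum complex_norm_square mult.commute del: of_real_power)

lemma herm_dot_self_nonneg: "Re (herm_dot x x) \<ge> 0"
  by (simp add: herm_dot_self sum_nonneg)

lemma Re_herm_dot_commute: "dim_vec x = dim_vec y \<Longrightarrow> Re (herm_dot x y) = Re (herm_dot y x)"
  by (simp add: herm_dot_eq_sum mult.commute)

lemma herm_dot_append:
  assumes "x \<in> carrier_vec n" "x' \<in> carrier_vec n" "y \<in> carrier_vec m" "y' \<in> carrier_vec m"
  shows "herm_dot (x @\<^sub>v y) (x' @\<^sub>v y') = herm_dot x x' + herm_dot y y'"
proof -
  have "conjugate (x @\<^sub>v y) = conjugate x @\<^sub>v conjugate y"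
    by (rule eq_vecI) auto
  then show ?thesis
    unfolding herm_dot_def using assms by (simp add: scalar_prod_append[where ?n1.0 = n and ?n2.0 = m])
qed

lemma mat_adjoint_index:
  "i < dim_col A \<Longrightarrow> j < dim_row A \<Longrightarrow> mat_adjoint A $$ (i, j) = conjugate (A $$ (j, i))"
  by (simp add: mat_adjoint_def mat_of_rows_index)

lemma mat_adjoint_carrier: "A \<in> carrier_mat n m \<Longrightarrow> mat_adjoint A \<in> carrier_mat m n"
  unfolding mat_adjoint_def by auto

lemma herm_dot_mat_adjoint:
  assumes A: "A \<in> carrier_mat n m" and x: "x \<in> carrier_vec m" and y: "y \<in> carrier_vec n"
  shows "herm_dot x (mat_adjoint A *\<^sub>v y) = herm_dot (A *\<^sub>v x) y"
proof -
  have dims: "dim_row A = n" "dim_col A = m" "dim_vec x = m" "dim_vec y = n"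
    "dim_row (mat_adjoint A) = m" "dim_col (mat_adjoint A) = n"
    using A x y mat_adjoint_carrier[OF A] by auto
  have "herm_dot x (mat_adjoint A *\<^sub>v y) = (\<Sum>i<m. \<Sum>j<n. cnj (x $ i) * (cnj (A $$ (j, i)) * y $ j))"
    using dims
    by (simp add: herm_dot_eq_sum scalar_prod_def mat_adjoint_index sum_distrib_left atLeast0LessThan)
  also have "\<dots> = (\<Sum>j<n. \<Sum>i<m. cnj (x $ i) * (cnj (A $$ (j, i)) * y $ j))"
    by (rule sum.swap)
  also have "\<dots> = herm_dot (A *\<^sub>v x) y"
    using dims
    by (simp add: herm_dot_eq_sum scalar_prod_def sum_distrib_left sum_distrib_right atLeast0LessThan mult_ac)
  finally show ?thesis .
qed

text \<open>Moving the adjoint to the left argument turns the form into a squared norm. This makes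
  the signal power of a user both nonnegative and equal to \<open>|Q w|^2\<close>.\<close>

lemma quad_form_gram:
  assumes A: "A \<in> carrier_mat n m" and x: "x \<in> carrier_vec m"
  shows "quad_form (mat_adjoint A * A) x = Re (herm_dot (A *\<^sub>v x) (A *\<^sub>v x))"
  using herm_dot_mat_adjoint[OF A x mult_mat_vec_carrier[OF A x]]
    assoc_mult_mat_vec[OF mat_adjoint_carrier[OF A] A x]
  by (simp add: quad_form_def)

text \<open>The matrix has rank at most one: with \<open>z = x^T w\<close> the form equals
  \<open>c |z|^2\<close>.\<close>

lemma quad_form_outer_prod_nonneg:
  assumes x: "x \<in> carrier_vec n" and w: "w \<in> carrier_vec n" and c: "c \<ge> 0"
  shows "quad_form (complex_of_real c \<cdot>\<^sub>m outer_prod (conjugate x) x) w \<ge> 0"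
proof -
  define z where "z = (\<Sum>j<n. x $ j * w $ j)"
  have dims: "dim_vec x = n" "dim_vec w = n"
    using x w by auto
  have "(complex_of_real c \<cdot>\<^sub>m outer_prod (conjugate x) x) *\<^sub>v w
      = Matrix.vec n (\<lambda>i. complex_of_real c * cnj (x $ i) * z)"
    using dims
    by (intro eq_vecI)
      (auto simp: outer_prod_def scalar_prod_def z_def sum_distrib_left atLeast0LessThan mult_ac)
  then have "herm_dot w ((complex_of_real c \<cdot>\<^sub>m outer_prod (conjugate x) x) *\<^sub>v w)
      = complex_of_real c * (z * cnj z)"
    using dims
    by (simp add: herm_dot_eq_sum z_def sum_distrib_left mult_ac)
  also have "\<dots> = complex_of_real (c * (cmod z)\<^sup>2)"
    by (simp add: complex_norm_square[symmetric])
  finally show ?thesis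
    using c by (simp add: quad_form_def)
qed

text \<open>Cutting \<open>w\<close> along the first block makes the form a sum of one form per
  part, so induction on the list of blocks applies, with \<open>w\<close> generalised.\<close>

lemma quad_form_diag_block_mat_nonneg:
  assumes "\<And>B. B \<in> set Bs \<Longrightarrow> square_mat B"
    and "\<And>B x. B \<in> set Bs \<Longrightarrow> x \<in> carrier_vec (dim_row B) \<Longrightarrow> quad_form B x \<ge> 0"
    and "w \<in> carrier_vec (dim_row (diag_block_mat Bs))"
  shows "quad_form (diag_block_mat Bs) w \<ge> 0"
  using assms
proof (induction Bs arbitrary: w)
  case Nil
  then show ?case
    by (simp add: quad_form_def herm_dot_def scalar_prod_def)
next
  case (Cons B Bs)
  let ?D = "diag_block_mat Bs"
  define n where "n = dim_row B"
  define m where "m = dim_row ?D"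
  \<comment> \<open>The dimensions of the block matrix are the sums of these two lists, so it is
    square too.\<close>
  have "map dim_col Bs = map dim_row Bs"
    using Cons.prems(1) by auto
  then have "dim_col ?D = dim_row ?D"
    unfolding dim_diag_block_mat by (rule arg_cong)
  then have D: "?D \<in> carrier_mat m m"
    unfolding m_def by auto
  have B: "B \<in> carrier_mat n n"
    using Cons.prems(1) unfolding n_def by (intro carrier_matI) auto
  have "w \<in> carrier_vec (n + m)"
    using Cons.prems(3) by (simp add: n_def m_def Let_def)
  then have w: "w = vec_first w n @\<^sub>v vec_last w m"
    by simp
  have split: "diag_block_mat (B # Bs) *\<^sub>v w = B *\<^sub>v vec_first w n @\<^sub>v ?D *\<^sub>v vec_last w m"
    using mult_mat_vec_split[OF B D, of "vec_first w n" "vec_last w m"] B D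
    by (simp add: Let_def w[symmetric])
  have "herm_dot w (diag_block_mat (B # Bs) *\<^sub>v w)
      = herm_dot (vec_first w n) (B *\<^sub>v vec_first w n) + herm_dot (vec_last w m) (?D *\<^sub>v vec_last w m)"
    unfolding split by (subst w) (rule herm_dot_append[where n = n and m = m], use B D in auto)
  then have "quad_form (diag_block_mat (B # Bs)) w
      = quad_form B (vec_first w n) + quad_form ?D (vec_last w m)"
    by (simp add: quad_form_def)
  moreover have "quad_form B (vec_first w n) \<ge> 0"
    using Cons.prems(2) by (simp add: n_def)
  moreover have "quad_form ?D (vec_last w m) \<ge> 0"
    by (rule Cons.IH) (use Cons.prems(1,2) in \<open>auto simp: m_def\<close>)
  ultimately show ?case
    by simp
qed

section \<open>The error as a completed square, and its minimum as a rate\<close>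

text \<open>The square is completed separately in each entry. Keeping the squared distance as a sum
  over entries makes it visible that it vanishes at \<open>x = y / d\<close>.\<close>

lemma complete_square_herm_dot:
  assumes x: "x \<in> carrier_vec n" and y: "y \<in> carrier_vec n" and d: "d \<noteq> 0"
  shows "d * Re (herm_dot x x) - 2 * Re (herm_dot x y)
    = d * (\<Sum>i<n. (cmod (x $ i - y $ i / of_real d))\<^sup>2) - Re (herm_dot y y) / d"
proof -
  have dims: "dim_vec x = n" "dim_vec y = n"
    using x y by auto
  have "d * (cmod p)\<^sup>2 - 2 * Re (cnj p * q) = d * (cmod (p - q / of_real d))\<^sup>2 - (cmod q)\<^sup>2 / d"
    for p q :: complex
    using d unfolding cmod_power2 by (simp add: field_simps power2_eq_square)
  then have "(\<Sum>i<n. d * (cmod (x $ i))\<^sup>2 - 2 * Re (cnj (x $ i) * y $ i))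
      = (\<Sum>i<n. d * (cmod (x $ i - y $ i / of_real d))\<^sup>2 - (cmod (y $ i))\<^sup>2 / d)"
    by simp
  then show ?thesis
    using dims unfolding herm_dot_self Re_complex_of_real sum_subtractf
    by (simp add: herm_dot_eq_sum sum_distrib_left sum_divide_distrib)
qed

text \<open>The coefficient of \<open>|a|^2\<close> in the error is the total received power
  \<open>d\<close>, noise included. For \<open>d > 0\<close> the last summand is therefore the
  minimum of the error over the receiver \<open>a\<close>.\<close>

lemma mse_eq_complete_square:
  fixes S N K r W Q \<Omega> \<Omega>t \<sigma> k
  defines "w \<equiv> stack_vec S N (\<lambda>s. W s k)"
  defines "d \<equiv> interference S N K \<Omega>t W k + (\<sigma> k)\<^sup>2 + quad_form (\<Omega> k) w"
  assumes Q: "Q k \<in> carrier_mat r (S * N)" and gram: "\<Omega> k = mat_adjoint (Q k) * Q k"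
    and A: "A \<in> carrier_mat r K" and k: "k < K" and d: "d \<noteq> 0"
  shows "mse S N K \<Omega> \<Omega>t Q \<sigma> W A k
    = d * (\<Sum>i<r. (cmod (col A k $ i - (Q k *\<^sub>v w) $ i / of_real d))\<^sup>2)
      + (interference S N K \<Omega>t W k + (\<sigma> k)\<^sup>2) / d"
proof -
  let ?a = "col A k" and ?q = "Q k *\<^sub>v w"
  have w: "w \<in> carrier_vec (S * N)"
    by (simp add: w_def stack_vec_def)
  have a: "?a \<in> carrier_vec r" and q: "?q \<in> carrier_vec r"
    using A k Q w by auto
  \<comment> \<open>The two linear terms of the error are complex conjugates of each other, so
    together they contribute \<open>2 Re (a^H q)\<close>.\<close>
  have adj: "Re (herm_dot w (mat_adjoint (Q k) *\<^sub>v ?a)) = Re (herm_dot ?a ?q)"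
    unfolding herm_dot_mat_adjoint[OF Q w a]
    by (rule Re_herm_dot_commute) (use A Q in auto)
  have qf: "quad_form (\<Omega> k) w = Re (herm_dot ?q ?q)"
    unfolding gram by (rule quad_form_gram[OF Q w])
  have "mse S N K \<Omega> \<Omega>t Q \<sigma> W A k = d * Re (herm_dot ?a ?a) - 2 * Re (herm_dot ?a ?q) + 1"
    using adj by (simp add: mse_def Let_def w_def[symmetric] d_def algebra_simps power2_eq_square)
  \<comment> \<open>What remains beside the square is \<open>1 - |q|^2 / d\<close>, and
    \<open>d - |q|^2\<close> is interference plus noise.\<close>
  then show ?thesis
    unfolding complete_square_herm_dot[OF a q d]
    using d by (simp add: d_def qf[symmetric] field_simps)
qed

text \<open>The minimal error is the reciprocal of one plus the signal-to-interference-plus-noise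
  ratio.\<close>

lemma log_mmse_eq_neg_rate:
  assumes "interference S N K \<Omega>t W k + (\<sigma> k)\<^sup>2 > 0"
    and "quad_form (\<Omega> k) (stack_vec S N (\<lambda>s. W s k)) \<ge> 0"
  shows "log 2 ((interference S N K \<Omega>t W k + (\<sigma> k)\<^sup>2)
      / (interference S N K \<Omega>t W k + (\<sigma> k)\<^sup>2 + quad_form (\<Omega> k) (stack_vec S N (\<lambda>s. W s k))))
    = - rate S N K \<Omega> \<Omega>t \<sigma> W k"
proof -
  define T where "T = interference S N K \<Omega>t W k + (\<sigma> k)\<^sup>2"
  define s where "s = quad_form (\<Omega> k) (stack_vec S N (\<lambda>s. W s k))"
  have "1 + s / T = (T + s) / T"
    using assms by (simp add: T_def field_simps)
  moreover have "log 2 (T / (T + s)) = - log 2 ((T + s) / T)"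
    using assms by (simp add: T_def s_def log_divide)
  ultimately show ?thesis
    by (simp add: rate_def T_def s_def)
qed

section \<open>The equivalence for given matrices\<close>

text \<open>\<open>noise\<close>, \<open>psd\<close> and \<open>gram\<close> make all denominators
  and minimal errors positive; \<open>weights\<close> allows the bounds of the single users to be
  scaled and added up. The rest is partial minimisation with \<open>y = (A, u)\<close>.\<close>

lemma P1_optimal_iff_P3_optimal:
  fixes W :: "nat \<Rightarrow> nat \<Rightarrow> complex Matrix.vec"
  assumes noise: "\<And>k. k < K \<Longrightarrow> (\<sigma> k)\<^sup>2 > 0"
    and weights: "\<And>k. k < K \<Longrightarrow> \<beta> k \<ge> 0"
    and Q: "\<And>k. k < K \<Longrightarrow> Q k \<in> carrier_mat r (S * N)"
    and gram: "\<And>k. k < K \<Longrightarrow> \<Omega> k = mat_adjoint (Q k) * Q k"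
    and psd: "\<And>k w. k < K \<Longrightarrow> w \<in> carrier_vec (S * N) \<Longrightarrow> quad_form (\<Omega>t k) w \<ge> 0"
  shows "P1_optimal S N K \<Omega> \<Omega>t \<sigma> \<beta> P W \<longleftrightarrow> (\<exists>A u. P3_optimal S N K r \<Omega> \<Omega>t Q \<sigma> \<beta> P W A u)"
proof -
  \<comment> \<open>For user \<open>k\<close>, \<open>T\<close> is interference plus noise,
    \<open>d\<close> the total received power, and \<open>T / d\<close> will be the minimal
    error.\<close>
  define T where "T W k = interference S N K \<Omega>t W k + (\<sigma> k)\<^sup>2" for W k
  define d where "d W k = T W k + quad_form (\<Omega> k) (stack_vec S N (\<lambda>s. W s k))" for W k
  define q where "q W k = Q k *\<^sub>v stack_vec S N (\<lambda>s. W s k)" for W k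
  define c :: real where "c = (1 + ln (ln 2)) / ln 2"
  define obj where "obj = (\<lambda>(W, A, u). \<Sum>k<K. \<beta> k * (u k * mse S N K \<Omega> \<Omega>t Q \<sigma> W A k - log 2 (u k)))"
  have stack: "stack_vec S N x \<in> carrier_vec (S * N)" for x
    by (simp add: stack_vec_def)
  have T_pos: "T W k > 0" if "k < K" for W k
    using noise[OF that] psd[OF that stack] unfolding T_def interference_def
    by (intro add_nonneg_pos sum_nonneg) auto
  have qf_nonneg: "quad_form (\<Omega> k) (stack_vec S N (\<lambda>s. W s k)) \<ge> 0" if "k < K" for W k
    unfolding gram[OF that] quad_form_gram[OF Q[OF that] stack] by (rule herm_dot_self_nonneg)
  have d_pos: "d W k > 0" if "k < K" for W k
    using T_pos[OF that] qf_nonneg[OF that] unfolding d_def by (simp add: add_pos_nonneg)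
  have mmse_pos: "T W k / d W k > 0" if "k < K" for W k
    using T_pos[OF that] d_pos[OF that] by simp
  have log_mmse: "log 2 (T W k / d W k) = - rate S N K \<Omega> \<Omega>t \<sigma> W k" if "k < K" for W k
    using log_mmse_eq_neg_rate T_pos[OF that] qf_nonneg[OF that] unfolding T_def d_def by blast
  have mse: "mse S N K \<Omega> \<Omega>t Q \<sigma> W A k
      = d W k * (\<Sum>i<r. (cmod (col A k $ i - q W k $ i / of_real (d W k)))\<^sup>2) + T W k / d W k"
    if "k < K" "A \<in> carrier_mat r K" for W A k
    using mse_eq_complete_square[where k = k and Q = Q and \<Omega> = \<Omega>, OF Q[OF that(1)] gram[OF that(1)] that(2,1)]
      d_pos[OF that(1), of W]
    unfolding d_def T_def q_def by simp
  have lower: "(\<Sum>k<K. \<beta> k * c) - (\<Sum>k<K. \<beta> k * rate S N K \<Omega> \<Omega>t \<sigma> W k) \<le> obj (W, A, u)"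
    if "A \<in> carrier_mat r K" "\<forall>k<K. u k > 0" for W A u
  proof -
    have "\<beta> k * c - \<beta> k * rate S N K \<Omega> \<Omega>t \<sigma> W k
        \<le> \<beta> k * (u k * mse S N K \<Omega> \<Omega>t Q \<sigma> W A k - log 2 (u k))" if k: "k < K" for k
    proof -
      have u: "u k > 0"
        using k \<open>\<forall>k<K. u k > 0\<close> by simp
      have "T W k / d W k \<le> mse S N K \<Omega> \<Omega>t Q \<sigma> W A k"
        unfolding mse[OF k \<open>A \<in> carrier_mat r K\<close>]
        using d_pos[OF k, of W] by (simp add: sum_nonneg)
      then have "u k * (T W k / d W k) \<le> u k * mse S N K \<Omega> \<Omega>t Q \<sigma> W A k"
        using u by (intro mult_left_mono) auto
      then have "c - rate S N K \<Omega> \<Omega>t \<sigma> W k \<le> u k * mse S N K \<Omega> \<Omega>t Q \<sigma> W A k - log 2 (u k)"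
        using mult_minus_log_ge[OF mmse_pos[OF k, of W] u] log_mmse[OF k, of W] unfolding c_def by linarith
      then show ?thesis
        using mult_left_mono[OF _ weights[OF k]] by (simp add: right_diff_distrib[symmetric])
    qed
    then show ?thesis
      unfolding obj_def prod.case sum_subtractf[symmetric] by (intro sum_mono) auto
  qed
  have attained: "\<exists>A u. (A \<in> carrier_mat r K \<and> (\<forall>k<K. u k > 0)) \<and>
      obj (W, A, u) = (\<Sum>k<K. \<beta> k * c) - (\<Sum>k<K. \<beta> k * rate S N K \<Omega> \<Omega>t \<sigma> W k)" for W
  proof -
    \<comment> \<open>Column \<open>k\<close> of \<open>A\<close> is the zero of the completed
      square of user \<open>k\<close>, and \<open>u k\<close> is the equality case of the
      logarithmic bound at the resulting error. Each column and each \<open>u k\<close> affects one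
      user only, so one pair serves all users at once.\<close>
    define A where "A = Matrix.mat r K (\<lambda>(i, k). q W k $ i / of_real (d W k))"
    define u where "u k = 1 / (T W k / d W k * ln 2)" for k
    have A: "A \<in> carrier_mat r K"
      by (simp add: A_def)
    have u: "\<forall>k<K. u k > 0"
      using T_pos d_pos by (simp add: u_def)
    have "u k * mse S N K \<Omega> \<Omega>t Q \<sigma> W A k - log 2 (u k) = c - rate S N K \<Omega> \<Omega>t \<sigma> W k" if k: "k < K" for k
    proof -
      have "mse S N K \<Omega> \<Omega>t Q \<sigma> W A k = T W k / d W k"
        unfolding mse[OF k A] using k by (simp add: A_def)
      then show ?thesis
        using mult_minus_log_eq[OF mmse_pos[OF k, of W]] log_mmse[OF k, of W]
        unfolding u_def c_def by simp
    qed
    then have "obj (W, A, u) = (\<Sum>k<K. \<beta> k * c) - (\<Sum>k<K. \<beta> k * rate S N K \<Omega> \<Omega>t \<sigma> W k)"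
      unfolding obj_def by (simp add: sum_subtractf[symmetric] right_diff_distrib[symmetric])
    then show ?thesis
      using A u by blast
  qed
  \<comment> \<open>The pair of \<open>A\<close> and \<open>u\<close> is treated as one variable
    \<open>y\<close>, whose constraint does not involve \<open>W\<close>.\<close>
  have "P1_optimal S N K \<Omega> \<Omega>t \<sigma> \<beta> P W
      \<longleftrightarrow> (\<exists>y. is_arg_min obj
            (\<lambda>(W, y). power_feasible S N K P W \<and> (case y of (A, u) \<Rightarrow> A \<in> carrier_mat r K \<and> (\<forall>k<K. u k > 0)))
            (W, y))"
    unfolding P1_optimal_def
    by (rule is_arg_max_iff_ex_is_arg_min[where c = "\<Sum>k<K. \<beta> k * c"]) (use lower attained in auto)
  then show ?thesis
    unfolding P3_optimal_def obj_def by (simp add: case_prod_unfold)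
qed

section \<open>Application to the satellite channel model\<close>

lemma steering_carrier: "steering Nv Nh x y \<in> carrier_vec (Nv * Nh)"
  by (simp add: steering_def steering_factor_def kron_vec_def)

theorem proposition2:
  fixes M :: "'o measure"
    and S Nv Nh NT K r :: nat
    and a \<phi> :: "nat \<Rightarrow> nat \<Rightarrow> 'o \<Rightarrow> complex"
    and \<kappa> \<gamma> \<theta>x \<theta>y :: "nat \<Rightarrow> nat \<Rightarrow> real"
    and v :: "nat \<Rightarrow> nat \<Rightarrow> complex Matrix.vec"
    and h :: "nat \<Rightarrow> nat \<Rightarrow> 'o \<Rightarrow> complex Matrix.vec"
    and \<phi>bar \<rho> :: "nat \<Rightarrow> nat \<Rightarrow> complex"
    and \<Omega>blk :: "nat \<Rightarrow> nat \<Rightarrow> nat \<Rightarrow> complex Matrix.mat"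
    and \<Omega> \<Omega>t Q :: "nat \<Rightarrow> complex Matrix.mat"
    and \<sigma> \<beta> P :: "nat \<Rightarrow> real"
    and W :: "nat \<Rightarrow> nat \<Rightarrow> complex Matrix.vec"
  assumes "prob_space M"
    and "S \<ge> 1" "Nv \<ge> 1" "Nh \<ge> 1" "K \<ge> 1" "NT = Nv * Nh"
    and "\<And>s k. s < S \<Longrightarrow> k < K \<Longrightarrow> \<kappa> s k > 0"
    and "\<And>s k. s < S \<Longrightarrow> k < K \<Longrightarrow> \<gamma> s k > 0"
    and "\<And>s k. s < S \<Longrightarrow> k < K \<Longrightarrow> complex_rician M (a s k) (\<kappa> s k) (\<gamma> s k)"
    and "\<And>s k. s < S \<Longrightarrow> k < K \<Longrightarrow> (\<integral>\<omega>. (cmod (a s k \<omega>))\<^sup>2 \<partial>M) = \<gamma> s k"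
    and "\<And>s k. s < S \<Longrightarrow> k < K \<Longrightarrow> \<phi> s k \<in> borel_measurable M"
    and "\<And>s k. s < S \<Longrightarrow> k < K \<Longrightarrow> (AE \<omega> in M. cmod (\<phi> s k \<omega>) = 1)"
    and "\<And>s k. s < S \<Longrightarrow> k < K \<Longrightarrow> \<phi>bar s k = (\<integral>\<omega>. \<phi> s k \<omega> \<partial>M)"
    and "\<And>s k. s < S \<Longrightarrow> k < K \<Longrightarrow> v s k = steering Nv Nh (\<theta>x s k) (\<theta>y s k)"
    and "\<And>s k \<omega>. s < S \<Longrightarrow> k < K \<Longrightarrow> h s k \<omega> = (a s k \<omega> * \<phi> s k \<omega>) \<cdot>\<^sub>v v s k"
    and "\<And>s k. s < S \<Longrightarrow> k < K \<Longrightarrow>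
           \<rho> s k = complex_of_real (sqrt (\<kappa> s k * \<gamma> s k / (2 * (\<kappa> s k + 1)))) * (1 + \<i>) * \<phi>bar s k"
    and "\<And>s k. s < S \<Longrightarrow> k < K \<Longrightarrow> expect_vec M NT (h s k) = \<rho> s k \<cdot>\<^sub>v v s k"
    and "\<And>s1 s2 k. s1 < S \<Longrightarrow> s2 < S \<Longrightarrow> k < K \<Longrightarrow>
           \<Omega>blk s1 s2 k = correlation M NT (h s1 k) (h s2 k)"
    and "\<And>s k. s < S \<Longrightarrow> k < K \<Longrightarrow>
           \<Omega>blk s s k = complex_of_real (\<gamma> s k) \<cdot>\<^sub>m outer_prod (conjugate (v s k)) (v s k)"
    and "\<And>s1 s2 k. s1 < S \<Longrightarrow> s2 < S \<Longrightarrow> s1 \<noteq> s2 \<Longrightarrow> k < K \<Longrightarrow>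
           \<Omega>blk s1 s2 k = (cnj (\<rho> s1 k) * \<rho> s2 k) \<cdot>\<^sub>m outer_prod (conjugate (v s1 k)) (v s2 k)"
    and "\<And>k. k < K \<Longrightarrow>
           \<Omega> k = correlation M (S * NT) (\<lambda>\<omega>. stack_vec S NT (\<lambda>s. h s k \<omega>)) (\<lambda>\<omega>. stack_vec S NT (\<lambda>s. h s k \<omega>))"
    and "\<And>k. k < K \<Longrightarrow> \<Omega>t k = diag_block_mat (map (\<lambda>s. \<Omega>blk s s k) [0..<S])"
    and "\<And>k. k < K \<Longrightarrow> Q k \<in> carrier_mat r (S * NT)"
    and "\<And>k. k < K \<Longrightarrow> \<Omega> k = mat_adjoint (Q k) * Q k"
    and "\<And>k. k < K \<Longrightarrow> (\<sigma> k)\<^sup>2 > 0"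
    and "\<And>k. k < K \<Longrightarrow> \<beta> k \<ge> 0"
    and "\<And>s. s < S \<Longrightarrow> P s > 0"
  shows "P1_optimal S NT K \<Omega> \<Omega>t \<sigma> \<beta> P W \<longleftrightarrow>
         (\<exists>A u. P3_optimal S NT K r \<Omega> \<Omega>t Q \<sigma> \<beta> P W A u)"
proof -
  have v: "v s k \<in> carrier_vec NT" if "s < S" "k < K" for s k
    using assms(6) assms(14)[OF that] steering_carrier by simp
  \<comment> \<open>Each diagonal block is a positive multiple \<open>\<gamma> s k\<close> of a
    rank-one form in the steering vector, and nonnegativity passes from the blocks to
    \<open>\<Omega>t k\<close>.\<close>
  have "quad_form (\<Omega>t k) w \<ge> 0" if k: "k < K" and w: "w \<in> carrier_vec (S * NT)" for k w
  proof -
    have blk: "\<Omega>blk s s k \<in> carrier_mat NT NT" "\<And>x. x \<in> carrier_vec NT \<Longrightarrow> quad_form (\<Omega>blk s s k) x \<ge> 0"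
      if "s < S" for s
      using assms(8)[OF that k] v[OF that k] quad_form_outer_prod_nonneg[OF v[OF that k]]
      unfolding assms(19)[OF that k] by (auto simp: outer_prod_def)
    \<comment> \<open>The \<open>S\<close> blocks have \<open>NT\<close> rows each, so a stacked
      vector has the length that the block-diagonal form expects.\<close>
    have "map dim_row (map (\<lambda>s. \<Omega>blk s s k) [0..<S]) = map (\<lambda>_. NT) [0..<S]"
      using carrier_matD(1)[OF blk(1)] by auto
    then have "dim_row (diag_block_mat (map (\<lambda>s. \<Omega>blk s s k) [0..<S])) = S * NT"
      unfolding dim_diag_block_mat by (simp only: sum_list_triv) simp
    then show ?thesis
      unfolding assms(22)[OF k]
      using w blk(2) carrier_matD[OF blk(1)] by (intro quad_form_diag_block_mat_nonneg) auto
  qed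
  then show ?thesis
    by (intro P1_optimal_iff_P3_optimal assms(23-26))
qed

end
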